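(* Let $K\subset\mathbb{R}^d$ be compact and convex, let $g$ be an $\mathbb{R}^d$-valued function of two variables that is Lipschitz continuous in both arguments, let $\phi_1,\dots,\phi_M\in\mathbf{C}^1(K)$ be kernel functions, and let $B_k=[b^k_{\ell,j}]_{\ell,j=1}^M\in\mathbb{R}^{M\times M}$, $k=1,\dots,M$. Let $x_1,\dots,x_N$ be agents with $\dot x_i(t)=\frac1N\sum_{j=1}^N g(x_i(t),x_j(t))$, $i=1,\dots,N$, and assume that $x_i(t)\in K$ for all $i$ and all $t\in[0,T]$. Let $m(t)=(m_1(t),\dots,m_M(t))$ be the true moments, $m_k(t)=\frac1N\sum_{i=1}^N\phi_k(x_i(t))$, and let $\overline m(t)\in\mathbb{R}^M$ be the solution of the approximate dynamics $$\dot{\overline m}_k(t)=\sum_{\ell,j=1}^M b^k_{\ell,j}\,\overline m_\ell(t)\,\overline m_j(t)=\overline m(t)^TB_k\,\overline m(t),\qquad k=1,\dots,M.$$ Let $D\subset\mathbb{R}^M$ be a compact and convex set, and assume that $\overline m(t)\in D$ for $t\in[0,\overline T]$. Define $$\varepsilon_k(x,y)=\frac{\partial\phi_k(x)}{\partial x}g(x,y)-\sum_{\ell,j=1}^M b^k_{\ell,j}\,\phi_\ell(x)\phi_j(y),\qquad \beta=\max_{m\in D}\sum_{\ell=1}^M\nu[m_\ell\widetilde B_\ell],$$ where $\widetilde B_\ell=[b^i_{\ell,j}+b^i_{j,\ell}]_{i,j=1}^M$. Then for $t\in[0,\min(T,\overline T)]$ the norm of the error trajectory $\Delta m(t)=m(t)-\overline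 m(t)$ is bounded by $$\|\Delta m(t)\|\le\|\Delta m(0)\|e^{\beta t}+\frac{e^{\beta t}-1}{\beta}\sqrt{\sum_{k=1}^M\max_{x,y\in K}\varepsilon_k(x,y)^2}\quad\text{if }\beta\neq0,$$ and by $$\|\Delta m(t)\|\le\|\Delta m(0)\|+t\sqrt{\sum_{k=1}^M\max_{x,y\in K}\varepsilon_k(x,y)^2}\quad\text{if }\beta=0.$$
   Context: $\|\cdot\|$ denotes the Euclidean vector norm and the induced matrix norm. $\mathbf{C}^1(K)$ is the set of continuously differentiable real-valued functions on $K$; $\partial\phi_k/\partial x$ is the gradient as a row vector. The logarithmic $2$-norm of a square real matrix $A$ is $\nu[A]=\lim_{h\to0^+}\frac{\|I+hA\|-1}{h}$, which equals $\lambda_{\max}(A+A^* )/2$, where $\lambda_{\max}$ is the maximal eigenvalue. In $\widetilde B_\ell$, $i$ is the row index and $j$ the column index. The true moments satisfy $\dot m_k(t)=\int_K\int_K\frac{\partial\phi_k(x)}{\partial x}g(x,y)\,d\mu_t(x)\,d\mu_t(y)$ with $\mu_t=\frac1N\sum_{i=1}^N\delta_{x_i(t)}$. A natural choice of $D$ is the set of all vectors $\left(\int_K\phi_k\,d\mu\right)_{k=1}^M$ with $\mu$ a nonnegative measure on $K$ of total mass $1$.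
   Formalization: The formal theorem additionally assumes that the true moments m(t) lie in D for t in [0, min(T, T̄)]; without this the claim fails (e.g. D={0}, m̄=0, φ(x)=x, g(x,y)=xy, b=1 on K=[0,2]). It holds automatically for the natural choice of D. *)

theory Defs
  imports "HOL-Analysis.Analysis"
begin

text \<open>
  The matrix norm is the operator norm induced by the Euclidean norm; \<^const>\<open>norm\<close> on the type
  \<open>real^'m^'m\<close> would be the Frobenius norm.
\<close>

definition log_norm :: "real^'m^'m \<Rightarrow> real" where
  "log_norm A = Lim (at_right 0) (\<lambda>h. (onorm ((*v) (mat 1 + h *\<^sub>R A)) - 1) / h)"

text \<open>
  The gradient is an explicit argument: when \<open>K\<close> has empty interior, the derivative within \<open>K\<close>
  determines it only in the directions tangent to \<open>K\<close>.
\<close>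

definition C1_on :: "(real^'d) set \<Rightarrow> (real^'d \<Rightarrow> real) \<Rightarrow> (real^'d \<Rightarrow> real^'d) \<Rightarrow> bool" where
  "C1_on K f f' \<longleftrightarrow>
     (\<forall>x\<in>K. (f has_derivative (\<lambda>h. f' x \<bullet> h)) (at x within K)) \<and> continuous_on K f'"

definition lipschitz_in_both_on ::
    "(real^'d) set \<Rightarrow> (real^'d \<Rightarrow> real^'d \<Rightarrow> real^'d) \<Rightarrow> bool" where
  "lipschitz_in_both_on K g \<longleftrightarrow>
     (\<exists>L. (\<forall>y\<in>K. L-lipschitz_on K (\<lambda>x. g x y)) \<and> (\<forall>x\<in>K. L-lipschitz_on K (\<lambda>y. g x y)))"

definition true_moments ::
    "('m \<Rightarrow> real^'d \<Rightarrow> real) \<Rightarrow> ('n::finite \<Rightarrow> real \<Rightarrow> real^'d) \<Rightarrow> real \<Rightarrow> real^'m" where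
  "true_moments \<phi> x t = (\<chi> k. (1 / real CARD('n)) * (\<Sum>i\<in>UNIV. \<phi> k (x i t)))"

text \<open>The entry \<open>B k $ l $ j\<close> is \<open>b\<^sup>k\<close> at row \<open>l\<close> and column \<open>j\<close>.\<close>

definition residual ::
    "('m \<Rightarrow> real^'d \<Rightarrow> real) \<Rightarrow> ('m \<Rightarrow> real^'d \<Rightarrow> real^'d) \<Rightarrow> (real^'d \<Rightarrow> real^'d \<Rightarrow> real^'d) \<Rightarrow>
      ('m \<Rightarrow> real^'m^'m) \<Rightarrow> 'm \<Rightarrow> real^'d \<Rightarrow> real^'d \<Rightarrow> real" where
  "residual \<phi> \<phi>' g B k x y =
     \<phi>' k x \<bullet> g x y - (\<Sum>l\<in>UNIV. \<Sum>j\<in>UNIV. B k $ l $ j * \<phi> l x * \<phi> j y)"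

definition B_tilde :: "('m \<Rightarrow> real^'m^'m) \<Rightarrow> 'm \<Rightarrow> real^'m^'m" where
  "B_tilde B l = (\<chi> i j. B i $ l $ j + B i $ j $ l)"

end

theory Submission
  imports Defs
begin

text \<open>
  For quadratic right-hand sides the mean value theorem is exact at the midpoint
  \<open>c = (m + mbar) / 2\<close>, which lies in \<open>D\<close> by convexity:
  \<open>m\<^sup>T B\<^sub>k m - mbar\<^sup>T B\<^sub>k mbar\<close> is the \<open>k\<close>-th entry of \<open>(\<Sum>l. c\<^sub>l B_tilde\<^sub>l) \<Delta>\<close>.
  Hence \<open>\<Delta>' = (\<Sum>l. c\<^sub>l B_tilde\<^sub>l) \<Delta> + e\<close>, where \<open>e\<close> averages the residuals over all pairs
  of agents.  As \<open>v \<bullet> A v \<le> log_norm A * \<parallel>v\<parallel>\<^sup>2\<close>, this gives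
  \<open>\<Delta> \<bullet> \<Delta>' \<le> \<beta> \<parallel>\<Delta>\<parallel>\<^sup>2 + E \<parallel>\<Delta>\<parallel>\<close>, and Gronwall's argument applies.
\<close>

section \<open>Logarithmic norm: existence of the limit and its bounds\<close>

text \<open>The triangle inequality gives the upper bound; Cauchy-Schwarz applied to
  \<open>v\<close> and its image under \<open>mat 1 + h *\<^sub>R A\<close> gives the lower one.
  Neither outer bound depends on \<open>h\<close>, so both survive the limit.\<close>

lemma log_norm_quotient_bounds:
  fixes A :: "real^'m^'m"
  assumes h: "h > 0"
  shows "(onorm ((*v) (mat 1 + h *\<^sub>R A)) - 1) / h \<le> onorm ((*v) A)"
    and "v \<bullet> (A *v v) \<le> (onorm ((*v) (mat 1 + h *\<^sub>R A)) - 1) / h * (norm v)\<^sup>2"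
proof -
  let ?q = "onorm ((*v) (mat 1 + h *\<^sub>R A))"
  have eq: "(mat 1 + h *\<^sub>R A) *v u = u + h *\<^sub>R (A *v u)" for u
    by (simp add: matrix_vector_mult_add_rdistrib scaleR_matrix_vector_assoc)
  have "?q \<le> 1 + h * onorm ((*v) A)"
  proof (rule onorm_le)
    fix u
    have "norm ((mat 1 + h *\<^sub>R A) *v u) \<le> norm u + h * norm (A *v u)"
      unfolding eq using norm_triangle_ineq[of u "h *\<^sub>R (A *v u)"] h by simp
    also have "\<dots> \<le> norm u + h * (onorm ((*v) A) * norm u)"
      using onorm[of "(*v) A" u] h by (simp add: matrix_vector_mul_bounded_linear)
    finally show "norm ((mat 1 + h *\<^sub>R A) *v u) \<le> (1 + h * onorm ((*v) A)) * norm u"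
      by (simp add: algebra_simps)
  qed
  then show "(?q - 1) / h \<le> onorm ((*v) A)"
    using h by (simp add: field_simps)
  have "(norm v)\<^sup>2 + h * (v \<bullet> (A *v v)) = v \<bullet> ((mat 1 + h *\<^sub>R A) *v v)"
    unfolding eq by (simp add: inner_add_right power2_norm_eq_inner)
  also have "\<dots> \<le> norm v * norm ((mat 1 + h *\<^sub>R A) *v v)"
    by (rule norm_cauchy_schwarz)
  also have "\<dots> \<le> norm v * (?q * norm v)"
    by (intro mult_left_mono onorm matrix_vector_mul_bounded_linear norm_ge_zero)
  finally have "h * (v \<bullet> (A *v v)) \<le> (?q - 1) * (norm v)\<^sup>2"
    by (simp add: power2_eq_square algebra_simps)
  then show "v \<bullet> (A *v v) \<le> (?q - 1) / h * (norm v)\<^sup>2"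
    using h by (simp add: field_simps)
qed

text \<open>\<open>mat 1 + h *\<^sub>R A\<close> is a convex combination of \<open>mat 1\<close> and
  \<open>mat 1 + k *\<^sub>R A\<close>, with weight \<open>h / k\<close> on the latter. So this is
  the monotonicity of difference quotients at 0 of a convex function.\<close>

lemma log_norm_quotient_mono:
  fixes A :: "real^'m^'m"
  assumes h: "0 < h" "h \<le> k"
  shows "(onorm ((*v) (mat 1 + h *\<^sub>R A)) - 1) / h \<le> (onorm ((*v) (mat 1 + k *\<^sub>R A)) - 1) / k"
proof -
  have k: "k > 0" using h by simp
  have eq: "(mat 1 + c *\<^sub>R A) *v u = u + c *\<^sub>R (A *v u)" for u c
    by (simp add: matrix_vector_mult_add_rdistrib scaleR_matrix_vector_assoc)
  let ?q = "\<lambda>h. onorm ((*v) (mat 1 + h *\<^sub>R A))"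
  have "?q h \<le> (1 - h / k) + (h / k) * ?q k"
  proof (rule onorm_le)
    fix u
    have "(mat 1 + h *\<^sub>R A) *v u = (1 - h / k) *\<^sub>R u + (h / k) *\<^sub>R ((mat 1 + k *\<^sub>R A) *v u)"
      unfolding eq using k by (simp add: algebra_simps)
    also have "norm \<dots> \<le> (1 - h / k) * norm u + (h / k) * norm ((mat 1 + k *\<^sub>R A) *v u)"
      using norm_triangle_ineq[of "(1 - h / k) *\<^sub>R u" "(h / k) *\<^sub>R ((mat 1 + k *\<^sub>R A) *v u)"] h k
      by simp
    also have "\<dots> \<le> (1 - h / k) * norm u + (h / k) * (?q k * norm u)"
      using h k by (intro add_left_mono mult_left_mono onorm matrix_vector_mul_bounded_linear) auto
    finally show "norm ((mat 1 + h *\<^sub>R A) *v u) \<le> (1 - h / k + h / k * ?q k) * norm u"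
      by (simp add: algebra_simps)
  qed
  then have "?q h - 1 \<le> h * ((?q k - 1) / k)"
    by (simp add: algebra_simps diff_divide_distrib)
  then show ?thesis
    using h by (simp add: field_simps)
qed

text \<open>\<open>Lim\<close> is a definite description and says nothing until convergence is
  known. The quotient increases with \<open>h\<close> and is bounded below through a unit vector, so
  its right limit at 0 is its infimum.\<close>

lemma log_norm_tendsto:
  fixes A :: "real^'m^'m"
  shows "((\<lambda>h. (onorm ((*v) (mat 1 + h *\<^sub>R A)) - 1) / h) \<longlongrightarrow> log_norm A) (at_right 0)"
proof -
  let ?q = "\<lambda>h. (onorm ((*v) (mat 1 + h *\<^sub>R A)) - 1) / h"
  obtain v :: "real^'m" where v: "norm v = 1"
    using vector_choose_size[of 1] by auto
  have low: "v \<bullet> (A *v v) \<le> ?q h" if "h > 0" for h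
    using log_norm_quotient_bounds(2)[OF that, of v A] v by simp
  have bdd: "bdd_below (?q ` {0<..})"
    using low by (intro bdd_belowI2[where m = "v \<bullet> (A *v v)"]) auto
  have "(?q \<longlongrightarrow> Inf (?q ` {0<..})) (at_right 0)"
  proof (rule order_tendstoI)
    fix a assume "a < Inf (?q ` {0<..})"
    then have "a < ?q h" if "h > 0" for h
      using cINF_lower[OF bdd, of h] that by auto
    then show "eventually (\<lambda>h. a < ?q h) (at_right 0)"
      by (rule eventually_mono[OF eventually_at_right_less])
  next
    fix a assume "Inf (?q ` {0<..}) < a"
    then obtain k where k: "k > 0" "?q k < a"
      by (subst (asm) cINF_less_iff[OF _ bdd]) auto
    have "?q h < a" if "0 < h" "h < k" for h
      using log_norm_quotient_mono[of h k A] that k by linarith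
    then show "eventually (\<lambda>h. ?q h < a) (at_right 0)"
      unfolding eventually_at_right_field using k(1) by blast
  qed
  then show ?thesis
    unfolding log_norm_def by (simp add: tendsto_Lim)
qed

text \<open>One half of the identity with the largest eigenvalue of the symmetric part of
  \<open>A\<close>; the error estimate rests on this half alone.\<close>

lemma inner_mult_le_log_norm:
  fixes A :: "real^'m^'m"
  shows "v \<bullet> (A *v v) \<le> log_norm A * (norm v)\<^sup>2"
proof (rule tendsto_lowerbound[OF tendsto_mult_right[OF log_norm_tendsto]])
  show "eventually (\<lambda>h. v \<bullet> (A *v v) \<le> (onorm ((*v) (mat 1 + h *\<^sub>R A)) - 1) / h * (norm v)\<^sup>2)
      (at_right 0)"
    using eventually_at_right_less[of "0::real"]
    by (rule eventually_mono) (rule log_norm_quotient_bounds)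
qed simp

lemma log_norm_le_onorm:
  fixes A :: "real^'m^'m"
  shows "log_norm A \<le> onorm ((*v) A)"
proof (rule tendsto_upperbound[OF log_norm_tendsto])
  show "eventually (\<lambda>h. (onorm ((*v) (mat 1 + h *\<^sub>R A)) - 1) / h \<le> onorm ((*v) A)) (at_right 0)"
    using eventually_at_right_less[of "0::real"]
    by (rule eventually_mono) (rule log_norm_quotient_bounds)
qed simp

text \<open>Makes the supremum that defines \<beta> a genuine upper bound. The operator norm
  dominates \<open>log_norm\<close> and is absolutely homogeneous, so a bound on \<open>D\<close>
  suffices and no continuity of \<open>log_norm\<close> is required.\<close>

lemma bdd_above_sum_log_norm:
  fixes D :: "(real^'m) set" and C :: "'m \<Rightarrow> real^'n^'n"
  assumes "bounded D"
  shows "bdd_above ((\<lambda>m. \<Sum>l\<in>UNIV. log_norm ((m $ l) *\<^sub>R C l)) ` D)"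
proof -
  obtain R where R: "\<And>m. m \<in> D \<Longrightarrow> norm m \<le> R"
    using assms unfolding bounded_iff by blast
  have "(\<Sum>l\<in>UNIV. log_norm ((m $ l) *\<^sub>R C l)) \<le> (\<Sum>l\<in>UNIV. R * onorm ((*v) (C l)))"
    if "m \<in> D" for m
  proof (rule sum_mono)
    fix l
    have "log_norm ((m $ l) *\<^sub>R C l) \<le> onorm (\<lambda>v. (m $ l) *\<^sub>R (C l *v v))"
      using log_norm_le_onorm[of "(m $ l) *\<^sub>R C l"] by (simp add: scaleR_matrix_vector_assoc)
    also have "\<dots> = \<bar>m $ l\<bar> * onorm ((*v) (C l))"
      by (rule onorm_scaleR) (rule matrix_vector_mul_bounded_linear)
    also have "\<dots> \<le> R * onorm ((*v) (C l))"
      using R[OF that] component_le_norm_cart[of m l]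
      by (intro mult_right_mono onorm_pos_le matrix_vector_mul_bounded_linear) simp
    finally show "log_norm ((m $ l) *\<^sub>R C l) \<le> R * onorm ((*v) (C l))" .
  qed
  then show ?thesis
    by (rule bdd_aboveI2)
qed

section \<open>Gronwall estimate for the norm\<close>

text \<open>
  The norm itself is not differentiable at the zeros of \<open>f\<close>, so the argument runs with
  \<open>sqrt (\<parallel>f\<parallel>\<^sup>2 + \<delta>\<^sup>2)\<close> and lets \<open>\<delta>\<close> tend to \<open>0\<close>; the term \<open>\<bar>\<beta>\<bar> * \<delta>\<close> is needed when \<open>\<beta> < 0\<close>.
\<close>

lemma norm_gronwall_inner:
  fixes f f' :: "real \<Rightarrow> 'a::real_inner"
  assumes f: "\<And>s. s \<in> {0..\<tau>} \<Longrightarrow> (f has_vector_derivative f' s) (at s within {0..\<tau>})"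
    and le: "\<And>s. s \<in> {0..\<tau>} \<Longrightarrow> f s \<bullet> f' s \<le> \<beta> * (norm (f s))\<^sup>2 + E * norm (f s)"
    and E: "E \<ge> 0" and t: "t \<in> {0..\<tau>}"
    and \<psi>: "\<And>s. (\<psi> has_real_derivative exp (- \<beta> * s)) (at s)" "\<psi> 0 = 0"
  shows "norm (f t) \<le> exp (\<beta> * t) * (norm (f 0) + E * \<psi> t)"
proof -
  have bound: "norm (f t) \<le> exp (\<beta> * t) * (norm (f 0) + \<delta> + (E + \<bar>\<beta>\<bar> * \<delta>) * \<psi> t)"
    if \<delta>: "\<delta> > 0" for \<delta>
  proof -
    define u where "u = (\<lambda>s. sqrt (f s \<bullet> f s + \<delta>\<^sup>2))"
    \<comment> \<open>The integrating factor turns the differential inequality into monotonicity of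
      \<open>w\<close>. Keeping \<open>\<psi>\<close> abstract, as the antiderivative of
      \<open>exp (- \<beta> * s)\<close> vanishing at 0, treats zero and nonzero \<beta> at
      once.\<close>
    define w where "w = (\<lambda>s. u s * exp (- \<beta> * s) - (E + \<bar>\<beta>\<bar> * \<delta>) * \<psi> s)"
    have pos: "f s \<bullet> f s + \<delta>\<^sup>2 > 0" for s
      using \<delta> by (simp add: add_nonneg_pos)
    have u\<delta>: "u s \<ge> \<delta>" and uf: "u s \<ge> norm (f s)" and u2: "(u s)\<^sup>2 = (norm (f s))\<^sup>2 + \<delta>\<^sup>2" for s
      using \<delta> pos[of s] by (auto simp: u_def power2_norm_eq_inner norm_eq_sqrt_inner
        intro!: real_le_rsqrt)
    have u0: "u s > 0" for s
      using u\<delta>[of s] \<delta> by linarith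
    have contf: "continuous_on {0..\<tau>} f"
      using f by (rule continuous_on_vector_derivative)
    have "w t \<le> w 0"
    \<comment> \<open>The derivative of \<open>f\<close> is two-sided only in the interior;
      continuity takes care of the endpoints.\<close>
    proof (rule DERIV_nonpos_imp_decreasing_open[of 0 t w])
      show "0 \<le> t" using t by simp
      have "continuous_on {0..t} f"
        using contf t by (auto elim: continuous_on_subset)
      moreover have "continuous_on {0..t} \<psi>"
        using \<psi>(1) by (intro continuous_at_imp_continuous_on) (auto intro: DERIV_isCont)
      ultimately show "continuous_on {0..t} w"
        unfolding w_def u_def by (intro continuous_intros)
    next
      fix s assume s: "0 < s" "s < t"
      then have s': "s \<in> {0..\<tau>}" "at s within {0..\<tau>} = at s"
        using t by (auto intro!: at_within_interior)
      have "((\<lambda>s. f s \<bullet> f s + \<delta>\<^sup>2) has_real_derivative 2 * (f s \<bullet> f' s)) (at s)"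
        using f[OF s'(1)] unfolding s'(2) has_vector_derivative_def has_field_derivative_def
        by (auto intro!: derivative_eq_intros ext simp: inner_commute algebra_simps)
      from DERIV_chain2[OF DERIV_real_sqrt[OF pos] this]
      have "(u has_real_derivative (f s \<bullet> f' s) / u s) (at s)"
        unfolding u_def by (simp add: field_simps)
      then have "(w has_real_derivative
          ((f s \<bullet> f' s) / u s - \<beta> * u s - (E + \<bar>\<beta>\<bar> * \<delta>)) * exp (- \<beta> * s)) (at s)"
        unfolding w_def using \<psi>(1)[of s]
        by (auto intro!: derivative_eq_intros simp: algebra_simps)
      moreover have "(f s \<bullet> f' s) / u s - \<beta> * u s - (E + \<bar>\<beta>\<bar> * \<delta>) \<le> 0"
      proof -
        have "f s \<bullet> f' s \<le> \<beta> * ((u s)\<^sup>2 - \<delta>\<^sup>2) + E * u s"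
          using le[OF s'(1)] mult_left_mono[OF uf[of s] E] u2[of s] by simp
        also have "\<dots> \<le> \<beta> * (u s)\<^sup>2 + \<bar>\<beta>\<bar> * (\<delta> * u s) + E * u s"
        proof -
          \<comment> \<open>One factor \<delta> is traded for \<open>u s\<close>, so that the
            regularization error is still a constant after division by \<open>u s\<close>.\<close>
          have "- \<beta> * \<delta>\<^sup>2 \<le> \<bar>\<beta>\<bar> * \<delta>\<^sup>2"
            by (intro mult_right_mono) auto
          also have "\<dots> \<le> \<bar>\<beta>\<bar> * (\<delta> * u s)"
            using u\<delta>[of s] \<delta> by (intro mult_left_mono) (auto simp: power2_eq_square)
          finally show ?thesis by (simp add: algebra_simps)
        qed
        also have "\<dots> = (\<beta> * u s + (E + \<bar>\<beta>\<bar> * \<delta>)) * u s"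
          by (simp add: power2_eq_square algebra_simps)
        finally show ?thesis
          using u0[of s] pos_divide_le_eq[of "u s" "f s \<bullet> f' s" "\<beta> * u s + (E + \<bar>\<beta>\<bar> * \<delta>)"]
          by linarith
      qed
      ultimately show "\<exists>y. (w has_real_derivative y) (at s) \<and> y \<le> 0"
        by (blast intro: mult_nonpos_nonneg exp_ge_zero)
    qed
    then have "u t * exp (- \<beta> * t) \<le> u 0 + (E + \<bar>\<beta>\<bar> * \<delta>) * \<psi> t"
      by (simp add: w_def \<psi>(2))
    moreover have "u 0 \<le> norm (f 0) + \<delta>"
      using \<delta> by (intro power2_le_imp_le[of "u 0"]) (auto simp: u2 power2_sum)
    ultimately have "u t * exp (- \<beta> * t) \<le> norm (f 0) + \<delta> + (E + \<bar>\<beta>\<bar> * \<delta>) * \<psi> t"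
      by linarith
    then have "u t \<le> exp (\<beta> * t) * (norm (f 0) + \<delta> + (E + \<bar>\<beta>\<bar> * \<delta>) * \<psi> t)"
      by (simp add: exp_minus field_simps)
    then show ?thesis
      using uf[of t] by linarith
  qed
  have "((\<lambda>\<delta>. exp (\<beta> * t) * (norm (f 0) + \<delta> + (E + \<bar>\<beta>\<bar> * \<delta>) * \<psi> t)) \<longlongrightarrow>
      exp (\<beta> * t) * (norm (f 0) + 0 + (E + \<bar>\<beta>\<bar> * 0) * \<psi> t)) (at_right 0)"
    by (intro tendsto_intros)
  then have "norm (f t) \<le> exp (\<beta> * t) * (norm (f 0) + 0 + (E + \<bar>\<beta>\<bar> * 0) * \<psi> t)"
    by (rule tendsto_lowerbound)
      (auto intro: eventually_mono[OF eventually_at_right_less[of "0::real"]] bound)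
  then show ?thesis by simp
qed

section \<open>Residuals and their average over pairs of agents\<close>

lemma bdd_above_residual_sq:
  fixes K :: "(real^'d) set" and \<phi> :: "'m::finite \<Rightarrow> real^'d \<Rightarrow> real"
  assumes K: "compact K" and g: "lipschitz_in_both_on K g" and \<phi>: "\<And>k. C1_on K (\<phi> k) (\<phi>' k)"
  shows "bdd_above ((\<lambda>(x, y). (residual \<phi> \<phi>' g B k x y)\<^sup>2) ` (K \<times> K))"
proof -
  obtain L where L: "\<And>y. y \<in> K \<Longrightarrow> L-lipschitz_on K (\<lambda>x. g x y)"
      "\<And>x. x \<in> K \<Longrightarrow> L-lipschitz_on K (g x)"
    using g unfolding lipschitz_in_both_on_def by auto
  \<comment> \<open>Separate continuity alone would not do: the Lipschitz constant in the second
    argument is uniform in the first, which yields joint continuity.\<close>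
  have "continuous_on (K \<times> K) (\<lambda>(x, y). g x y)"
  proof (rule continuous_on_TimesI)
    show "local_lipschitz K K g"
      using L(2) by (intro local_lipschitzI exI[of _ 1] exI[of _ L])
        (auto intro: lipschitz_on_subset)
    show "continuous_on K (\<lambda>x. g x y)" if "y \<in> K" for y
      using L(1)[OF that] by (rule lipschitz_on_continuous_on)
  qed
  moreover have "continuous_on K (\<phi> l)" for l
    using \<phi>[of l] unfolding C1_on_def by (auto intro: has_derivative_continuous_on)
  moreover have "continuous_on K (\<phi>' k)"
    using \<phi>[of k] unfolding C1_on_def by blast
  ultimately have "continuous_on (K \<times> K) (\<lambda>p. (residual \<phi> \<phi>' g B k (fst p) (snd p))\<^sup>2)"
    unfolding residual_def case_prod_beta
    by (intro continuous_intros continuous_on_compose2[of K _ "K \<times> K" fst]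
        continuous_on_compose2[of K _ "K \<times> K" snd]) auto
  then have "compact ((\<lambda>p. (residual \<phi> \<phi>' g B k (fst p) (snd p))\<^sup>2) ` (K \<times> K))"
    using K by (intro compact_continuous_image compact_Times)
  then show ?thesis
    unfolding case_prod_beta by (intro bounded_imp_bdd_above compact_imp_bounded)
qed

text \<open>The integral of the residual against the product of the empirical measure of
  \<open>z\<close> with itself. It is the defect with which the true moments satisfy the approximate
  dynamics.\<close>

definition mean_residual ::
    "('m \<Rightarrow> real^'d \<Rightarrow> real) \<Rightarrow> ('m \<Rightarrow> real^'d \<Rightarrow> real^'d) \<Rightarrow> (real^'d \<Rightarrow> real^'d \<Rightarrow> real^'d) \<Rightarrow>
      ('m \<Rightarrow> real^'m^'m) \<Rightarrow> ('n::finite \<Rightarrow> real^'d) \<Rightarrow> real^'m" where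
  "mean_residual \<phi> \<phi>' g B z =
     (\<chi> k. (1 / real CARD('n))\<^sup>2 * (\<Sum>i\<in>UNIV. \<Sum>j\<in>UNIV. residual \<phi> \<phi>' g B k (z i) (z j)))"

text \<open>Each component averages values whose absolute value is at most the square root of the
  corresponding supremum.\<close>

lemma norm_mean_residual_le:
  fixes z :: "'n::finite \<Rightarrow> real^'d" and \<phi> :: "'m::finite \<Rightarrow> real^'d \<Rightarrow> real"
  assumes K: "compact K" and g: "lipschitz_in_both_on K g" and \<phi>: "\<And>k. C1_on K (\<phi> k) (\<phi>' k)"
    and z: "\<And>i. z i \<in> K"
  shows "norm (mean_residual \<phi> \<phi>' g B z) \<le>
    sqrt (\<Sum>k\<in>UNIV. SUP (x, y)\<in>K \<times> K. (residual \<phi> \<phi>' g B k x y)\<^sup>2)"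
proof -
  let ?S = "\<lambda>k. SUP (x, y)\<in>K \<times> K. (residual \<phi> \<phi>' g B k x y)\<^sup>2"
  have "(mean_residual \<phi> \<phi>' g B z $ k)\<^sup>2 \<le> ?S k" for k
  proof -
    have sq: "(residual \<phi> \<phi>' g B k (z i) (z j))\<^sup>2 \<le> ?S k" for i j
      using cSUP_upper[OF SigmaI[OF z[of i] z[of j]] bdd_above_residual_sq[OF K g \<phi>, where B = B and k = k]]
      by simp
    then have S: "?S k \<ge> 0"
      using order_trans[OF zero_le_power2] by blast
    have "\<bar>\<Sum>i\<in>UNIV. \<Sum>j\<in>UNIV. residual \<phi> \<phi>' g B k (z i) (z j)\<bar> \<le>
        (\<Sum>i\<in>(UNIV::'n set). \<Sum>j\<in>(UNIV::'n set). sqrt (?S k))"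
      by (intro order_trans[OF sum_abs] sum_mono) (simp add: real_le_rsqrt sq)
    then have "\<bar>mean_residual \<phi> \<phi>' g B z $ k\<bar> \<le> sqrt (?S k)"
      by (simp add: mean_residual_def abs_mult power2_eq_square field_simps)
    then show ?thesis
      using S by (metis abs_le_square_iff real_sqrt_abs2 real_sqrt_pow2 abs_of_nonneg real_sqrt_ge_zero)
  qed
  then show ?thesis
    unfolding norm_vec_def L2_set_def by (auto intro!: real_sqrt_le_mono sum_mono)
qed

section \<open>Evolution of the true moments and the quadratic difference\<close>

text \<open>By the chain rule the derivative is an average of \<open>\<phi>' k\<close> against
  \<open>g\<close> over pairs of agents. A product of two moments is likewise an average over pairs,
  so the quadratic form cancels the subtracted part of the residuals.\<close>

lemma true_moments_has_derivative:
  fixes x :: "'n::finite \<Rightarrow> real \<Rightarrow> real^'d" and \<phi> :: "'m::finite \<Rightarrow> real^'d \<Rightarrow> real"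
  assumes \<phi>: "\<And>k. C1_on K (\<phi> k) (\<phi>' k)"
    and agents: "\<And>i. (x i has_vector_derivative
        (1 / real CARD('n)) *\<^sub>R (\<Sum>j\<in>UNIV. g (x i t) (x j t))) (at t within S)"
    and K: "\<And>i s. s \<in> S \<Longrightarrow> x i s \<in> K" and t: "t \<in> S"
  defines "m \<equiv> true_moments \<phi> x"
  shows "((\<lambda>s. m s $ k) has_real_derivative
      (\<Sum>l\<in>UNIV. \<Sum>j\<in>UNIV. B k $ l $ j * m t $ l * m t $ j)
        + mean_residual \<phi> \<phi>' g B (\<lambda>i. x i t) $ k) (at t within S)"
proof -
  let ?N = "1 / real CARD('n)"
  have d: "((\<lambda>s. \<phi> k (x i s)) has_real_derivative
      \<phi>' k (x i t) \<bullet> (?N *\<^sub>R (\<Sum>j\<in>UNIV. g (x i t) (x j t)))) (at t within S)" for i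
  proof -
    \<comment> \<open>The chain rule needs differentiability only within the image of the
      trajectory, a subset of \<open>K\<close>.\<close>
    have "(\<phi> k has_derivative (\<lambda>h. \<phi>' k (x i t) \<bullet> h)) (at (x i t) within x i ` S)"
      using \<phi>[of k] K t unfolding C1_on_def by (blast intro: has_derivative_subset)
    from diff_chain_within[OF agents[of i, unfolded has_vector_derivative_def] this]
    show ?thesis
      unfolding has_field_derivative_def o_def by (rule has_derivative_eq_rhs) auto
  qed
  have "B k $ l $ j * m t $ l * m t $ j =
      ?N\<^sup>2 * (\<Sum>p\<in>UNIV. \<Sum>q\<in>UNIV. B k $ l $ j * \<phi> l (x p t) * \<phi> j (x q t))" for l j
  proof -
    have "(\<Sum>p\<in>UNIV. \<Sum>q\<in>UNIV. B k $ l $ j * \<phi> l (x p t) * \<phi> j (x q t)) =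
        B k $ l $ j * ((\<Sum>p\<in>UNIV. \<phi> l (x p t)) * (\<Sum>q\<in>UNIV. \<phi> j (x q t)))"
      unfolding sum_product by (simp add: sum_distrib_left mult.assoc)
    then show ?thesis
      by (simp add: m_def true_moments_def power2_eq_square)
  qed
  then have "(\<Sum>l\<in>UNIV. \<Sum>j\<in>UNIV. B k $ l $ j * m t $ l * m t $ j) =
      ?N\<^sup>2 * (\<Sum>l\<in>UNIV. \<Sum>j\<in>UNIV. \<Sum>p\<in>UNIV. \<Sum>q\<in>UNIV. B k $ l $ j * \<phi> l (x p t) * \<phi> j (x q t))"
    by (simp only: sum_distrib_left)
  also have "(\<Sum>l\<in>UNIV. \<Sum>j\<in>UNIV. \<Sum>p\<in>UNIV. \<Sum>q\<in>UNIV. B k $ l $ j * \<phi> l (x p t) * \<phi> j (x q t)) =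
      (\<Sum>p\<in>UNIV. \<Sum>q\<in>UNIV. \<Sum>l\<in>UNIV. \<Sum>j\<in>UNIV. B k $ l $ j * \<phi> l (x p t) * \<phi> j (x q t))"
  proof -
    \<comment> \<open>Packing the indices into pairs reduces the exchange of two double sums to a
      single swap.\<close>
    let ?F = "\<lambda>r w. B k $ fst r $ snd r * \<phi> (fst r) (x (fst w) t) * \<phi> (snd r) (x (snd w) t)"
    have "(\<Sum>r\<in>UNIV \<times> UNIV. \<Sum>w\<in>UNIV \<times> UNIV. ?F r w) = (\<Sum>w\<in>UNIV \<times> UNIV. \<Sum>r\<in>UNIV \<times> UNIV. ?F r w)"
      by (rule sum.swap)
    then show ?thesis
      by (simp add: sum.cartesian_product' del: UNIV_Times_UNIV)
  qed
  finally have "(\<Sum>l\<in>UNIV. \<Sum>j\<in>UNIV. B k $ l $ j * m t $ l * m t $ j)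
        + mean_residual \<phi> \<phi>' g B (\<lambda>i. x i t) $ k =
      ?N\<^sup>2 * (\<Sum>i\<in>UNIV. \<Sum>j\<in>UNIV. \<phi>' k (x i t) \<bullet> g (x i t) (x j t))"
    by (simp add: mean_residual_def residual_def sum_subtractf algebra_simps)
  also have "\<dots> = ?N * (\<Sum>i\<in>UNIV. \<phi>' k (x i t) \<bullet> (?N *\<^sub>R (\<Sum>j\<in>UNIV. g (x i t) (x j t))))"
    by (simp add: inner_sum_right sum_distrib_left power2_eq_square mult_ac)
  finally have eq: "(\<Sum>l\<in>UNIV. \<Sum>j\<in>UNIV. B k $ l $ j * m t $ l * m t $ j)
        + mean_residual \<phi> \<phi>' g B (\<lambda>i. x i t) $ k =
      ?N * (\<Sum>i\<in>UNIV. \<phi>' k (x i t) \<bullet> (?N *\<^sub>R (\<Sum>j\<in>UNIV. g (x i t) (x j t))))" .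
  have m: "(\<lambda>s. m s $ k) = (\<lambda>s. ?N * (\<Sum>i\<in>UNIV. \<phi> k (x i s)))"
    by (simp add: m_def true_moments_def)
  show ?thesis
    unfolding eq m by (intro DERIV_cmult DERIV_sum d)
qed

text \<open>Polarization: \<open>(a $ l + b $ l) * (a $ j - b $ j)\<close> and its mirror image
  under exchange of \<open>l\<close> and \<open>j\<close> add up to twice
  \<open>a $ l * a $ j - b $ l * b $ j\<close>. The two summands of \<open>B_tilde\<close> supply
  the two orientations.\<close>

lemma quadratic_diff_eq_midpoint:
  fixes a b :: "real^'m" and B :: "'m \<Rightarrow> real^'m^'m"
  shows "(\<Sum>l\<in>UNIV. \<Sum>j\<in>UNIV. B k $ l $ j * a $ l * a $ j)
      - (\<Sum>l\<in>UNIV. \<Sum>j\<in>UNIV. B k $ l $ j * b $ l * b $ j)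
    = (\<Sum>l\<in>UNIV. ((midpoint a b $ l) *\<^sub>R B_tilde B l) *v (a - b)) $ k"
proof -
  have c: "midpoint a b $ l = (a $ l + b $ l) / 2" for l
    by (simp add: midpoint_def)
  let ?F = "\<lambda>l j. B k $ l $ j * (a $ l + b $ l) * (a $ j - b $ j) / 2"
  let ?G = "\<lambda>l j. B k $ j $ l * (a $ l + b $ l) * (a $ j - b $ j) / 2"
  have "(\<Sum>l\<in>UNIV. ((midpoint a b $ l) *\<^sub>R B_tilde B l) *v (a - b)) $ k =
      (\<Sum>l\<in>UNIV. \<Sum>j\<in>UNIV. ?F l j + ?G l j)"
    by (simp add: matrix_vector_mult_def B_tilde_def c algebra_simps add_divide_distrib diff_divide_distrib)
  \<comment> \<open>Exchanging the indices in the second sum gives both halves the coefficient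
    \<open>B k $ l $ j\<close>.\<close>
  also have "\<dots> = (\<Sum>l\<in>UNIV. \<Sum>j\<in>UNIV. ?F l j) + (\<Sum>l\<in>UNIV. \<Sum>j\<in>UNIV. ?G j l)"
    by (simp add: sum.distrib) (rule sum.swap)
  also have "\<dots> = (\<Sum>l\<in>UNIV. \<Sum>j\<in>UNIV. B k $ l $ j * a $ l * a $ j - B k $ l $ j * b $ l * b $ j)"
    unfolding sum.distrib[symmetric]
    by (intro sum.cong refl) (simp add: field_simps)
  finally show ?thesis
    by (simp add: sum_subtractf)
qed

text \<open>\<open>moments_in_D\<close> puts the segment between true and approximate moments inside
  the convex set \<open>D\<close>, hence also the midpoint at which \<beta> is applied. It holds
  automatically when \<open>D\<close> consists of the moment vectors of all probability measures on
  \<open>K\<close>. The maxima are written as suprema, of which the proof uses only that they are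
  upper bounds.\<close>

theorem theorem5:
  fixes K :: "(real^'d) set"
    and g :: "real^'d \<Rightarrow> real^'d \<Rightarrow> real^'d"
    and \<phi> :: "'m::finite \<Rightarrow> real^'d \<Rightarrow> real"
    and \<phi>' :: "'m \<Rightarrow> real^'d \<Rightarrow> real^'d"
    and B :: "'m \<Rightarrow> real^'m^'m"
    and x :: "'n::finite \<Rightarrow> real \<Rightarrow> real^'d"
    and mbar :: "real \<Rightarrow> real^'m"
    and D :: "(real^'m) set"
    and T Tbar \<beta> E :: real
    and \<Delta> :: "real \<Rightarrow> real^'m"
  assumes K: "compact K" "convex K"
    and g: "lipschitz_in_both_on K g"
    and \<phi>: "\<And>k. C1_on K (\<phi> k) (\<phi>' k)"
    and agents: "\<And>i t. t \<in> {0..T} \<Longrightarrow>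
      (x i has_vector_derivative (1 / real CARD('n)) *\<^sub>R (\<Sum>j\<in>UNIV. g (x i t) (x j t)))
        (at t within {0..T})"
    and agents_in_K: "\<And>i t. t \<in> {0..T} \<Longrightarrow> x i t \<in> K"
    and approx: "\<And>k t. t \<in> {0..Tbar} \<Longrightarrow>
      ((\<lambda>s. mbar s $ k) has_real_derivative
        (\<Sum>l\<in>UNIV. \<Sum>j\<in>UNIV. B k $ l $ j * mbar t $ l * mbar t $ j)) (at t within {0..Tbar})"
    and D: "compact D" "convex D"
    and approx_in_D: "\<And>t. t \<in> {0..Tbar} \<Longrightarrow> mbar t \<in> D"
    and moments_in_D: "\<And>t. t \<in> {0..min T Tbar} \<Longrightarrow> true_moments \<phi> x t \<in> D"
    and \<beta>: "\<beta> = (SUP m\<in>D. \<Sum>l\<in>UNIV. log_norm ((m $ l) *\<^sub>R B_tilde B l))"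
    and E: "E = sqrt (\<Sum>k\<in>UNIV. SUP (x, y)\<in>K \<times> K. (residual \<phi> \<phi>' g B k x y)\<^sup>2)"
    and \<Delta>: "\<And>t. \<Delta> t = true_moments \<phi> x t - mbar t"
  shows "\<forall>t\<in>{0..min T Tbar}.
      (\<beta> \<noteq> 0 \<longrightarrow> norm (\<Delta> t) \<le> norm (\<Delta> 0) * exp (\<beta> * t) + (exp (\<beta> * t) - 1) / \<beta> * E) \<and>
      (\<beta> = 0 \<longrightarrow> norm (\<Delta> t) \<le> norm (\<Delta> 0) + t * E)"
proof
  fix t assume t: "t \<in> {0..min T Tbar}"
  let ?\<tau> = "min T Tbar"
  let ?c = "\<lambda>s. midpoint (true_moments \<phi> x s) (mbar s)"
  let ?e = "\<lambda>s. mean_residual \<phi> \<phi>' g B (\<lambda>i. x i s)"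
  let ?A\<Delta> = "\<lambda>s. \<Sum>l\<in>UNIV. ((?c s $ l) *\<^sub>R B_tilde B l) *v \<Delta> s"
  have der: "(\<Delta> has_vector_derivative ?A\<Delta> s + ?e s) (at s within {0..?\<tau>})"
    if s: "s \<in> {0..?\<tau>}" for s
  proof -
    have "((\<lambda>s. \<Delta> s $ k) has_real_derivative (?A\<Delta> s + ?e s) $ k) (at s within {0..?\<tau>})" for k
    proof -
      have "((\<lambda>s. true_moments \<phi> x s $ k) has_real_derivative
          (\<Sum>l\<in>UNIV. \<Sum>j\<in>UNIV. B k $ l $ j * true_moments \<phi> x s $ l * true_moments \<phi> x s $ j)
            + ?e s $ k) (at s within {0..T})"
        using s by (intro true_moments_has_derivative[where K = K] \<phi> agents agents_in_K) auto
      then have "((\<lambda>s. true_moments \<phi> x s $ k) has_real_derivative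
          (\<Sum>l\<in>UNIV. \<Sum>j\<in>UNIV. B k $ l $ j * true_moments \<phi> x s $ l * true_moments \<phi> x s $ j)
            + ?e s $ k) (at s within {0..?\<tau>})"
        by (rule DERIV_subset) auto
      moreover have "((\<lambda>s. mbar s $ k) has_real_derivative
          (\<Sum>l\<in>UNIV. \<Sum>j\<in>UNIV. B k $ l $ j * mbar s $ l * mbar s $ j)) (at s within {0..?\<tau>})"
        using s by (intro DERIV_subset[OF approx]) auto
      ultimately show ?thesis
        unfolding \<Delta> vector_minus_component vector_add_component quadratic_diff_eq_midpoint[symmetric]
        by (auto intro: DERIV_diff simp: algebra_simps dest: DERIV_diff)
    qed
    then have "((\<lambda>s. \<Delta> s $ k) has_derivative (\<lambda>h. h * (?A\<Delta> s + ?e s) $ k))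
        (at s within {0..?\<tau>})" for k
      unfolding has_field_derivative_def by (rule has_derivative_eq_rhs) auto
    then show ?thesis
      unfolding has_vector_derivative_def
      by (subst has_derivative_componentwise_within) (auto simp: Basis_vec_def inner_axis)
  qed
  have e: "norm (?e s) \<le> E" if "s \<in> {0..?\<tau>}" for s
    unfolding E using that by (intro norm_mean_residual_le K g \<phi> agents_in_K) auto
  have E0: "E \<ge> 0"
    using e[OF t] norm_ge_zero order_trans by blast
  have le: "\<Delta> s \<bullet> (?A\<Delta> s + ?e s) \<le> \<beta> * (norm (\<Delta> s))\<^sup>2 + E * norm (\<Delta> s)"
    if s: "s \<in> {0..?\<tau>}" for s
  proof -
    have "?c s \<in> closed_segment (true_moments \<phi> x s) (mbar s)"
      by (rule midpoint_in_closed_segment)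
    then have c: "?c s \<in> D"
      using closed_segment_subset[OF moments_in_D[OF s] approx_in_D[of s] D(2)] s by auto
    \<comment> \<open>The bound is applied to each summand separately because \<beta> is built from
      a sum of logarithmic norms, not from the logarithmic norm of a sum.\<close>
    have "\<Delta> s \<bullet> ?A\<Delta> s \<le> (\<Sum>l\<in>UNIV. log_norm ((?c s $ l) *\<^sub>R B_tilde B l) * (norm (\<Delta> s))\<^sup>2)"
      unfolding inner_sum_right by (intro sum_mono inner_mult_le_log_norm)
    also have "\<dots> \<le> \<beta> * (norm (\<Delta> s))\<^sup>2"
      unfolding sum_distrib_right[symmetric] \<beta>
      by (intro mult_right_mono cSUP_upper c bdd_above_sum_log_norm compact_imp_bounded D) simp
    finally have "\<Delta> s \<bullet> ?A\<Delta> s \<le> \<beta> * (norm (\<Delta> s))\<^sup>2" .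
    moreover have "\<Delta> s \<bullet> ?e s \<le> E * norm (\<Delta> s)"
      using norm_cauchy_schwarz[of "\<Delta> s" "?e s"] mult_left_mono[OF e[OF s], of "norm (\<Delta> s)"]
      by (simp add: mult.commute)
    ultimately show ?thesis
      by (simp add: inner_add_right)
  qed
  note gronwall = norm_gronwall_inner[OF der le E0 t]
  show "(\<beta> \<noteq> 0 \<longrightarrow> norm (\<Delta> t) \<le> norm (\<Delta> 0) * exp (\<beta> * t) + (exp (\<beta> * t) - 1) / \<beta> * E) \<and>
      (\<beta> = 0 \<longrightarrow> norm (\<Delta> t) \<le> norm (\<Delta> 0) + t * E)"
  proof (intro conjI impI)
    assume b: "\<beta> \<noteq> 0"
    \<comment> \<open>Here \<open>\<psi> s\<close> is
      \<open>(1 - exp (- \<beta> * s)) / \<beta>\<close>.\<close>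
    have "norm (\<Delta> t) \<le> exp (\<beta> * t) * (norm (\<Delta> 0) + E * ((1 - exp (- \<beta> * t)) / \<beta>))"
      using b by (intro gronwall) (auto intro!: derivative_eq_intros)
    also have "\<dots> = norm (\<Delta> 0) * exp (\<beta> * t) + (exp (\<beta> * t) - 1) / \<beta> * E"
      using b by (simp add: exp_minus field_simps)
    finally show "norm (\<Delta> t) \<le> norm (\<Delta> 0) * exp (\<beta> * t) + (exp (\<beta> * t) - 1) / \<beta> * E" .
  next
    assume b: "\<beta> = 0"
    \<comment> \<open>For \<beta> = 0 the integrand is constantly 1 and \<open>\<psi>\<close> is the
      identity.\<close>
    have "norm (\<Delta> t) \<le> exp (\<beta> * t) * (norm (\<Delta> 0) + E * t)"
      using b by (intro gronwall) (auto intro!: derivative_eq_intros)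
    then show "norm (\<Delta> t) \<le> norm (\<Delta> 0) + t * E"
      using b by (simp add: mult.commute)
  qed
qed

end
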